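(* Let $p$ be a prime, $n$ a positive integer and $G=PSL(2,p^n)$. Then the number of connected components of $\mathcal{P}^*(G)$ is equal to $(p^{2n+1}-1)/(p-1)$.
   Context: For a finite group $G$, the proper power graph $\mathcal{P}^*(G)$ is the simple graph with vertex set $G\setminus\{1\}$ in which two distinct vertices are adjacent if and only if one is a power of the other.
   Formalization: The formal theorem assumes p^n > 3; the claim as stated fails for p^n = 2 (PSL(2,2) = S_3 has 4 components, the formula gives 7) and for p^n = 3 (PSL(2,3) = A_4 has 7 components, the formula gives 13). *)

theory Defs
  imports
    "HOL-Analysis.Determinants"
    "HOL-Algebra.Coset"
    "HOL-Computational_Algebra.Primes"
    "Graph_Theory.Pair_Digraph"
    "Graph_Theory.Digraph_Component"
begin

definition SL :: "('a::field ^ 'n ^ 'n) monoid" where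
  "SL = \<lparr>carrier = {A. det A = 1}, monoid.mult = (**), one = mat 1\<rparr>"

definition center :: "('a, 'b) monoid_scheme \<Rightarrow> 'a set" where
  "center G = {z \<in> carrier G. \<forall>x \<in> carrier G. z \<otimes>\<^bsub>G\<^esub> x = x \<otimes>\<^bsub>G\<^esub> z}"

definition PSL :: "('a::field ^ 'n ^ 'n) set monoid" where
  "PSL = SL Mod center SL"

(* A simple undirected graph is represented by its symmetric, loop-free set of ordered pairs
   (the locale pair_graph).  Every element of a finite group has finite order, so natural
   number exponents give all powers. *)
definition proper_power_graph :: "('a, 'b) monoid_scheme \<Rightarrow> 'a pair_pre_digraph" where
  "proper_power_graph G =
     (let V = carrier G - {\<one>\<^bsub>G\<^esub>} in
      \<lparr>pverts = V,
       parcs = {(x, y). x \<in> V \<and> y \<in> V \<and> x \<noteq> y \<and>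
         ((\<exists>k::nat. y = x [^]\<^bsub>G\<^esub> k) \<or> (\<exists>k::nat. x = y [^]\<^bsub>G\<^esub> k))}\<rparr>)"

(* Since the arc relation is symmetric, strong connectivity is ordinary connectivity, and the
   strongly connected components are exactly the connected components. *)
definition connected_components :: "'a pair_pre_digraph \<Rightarrow> ('a, 'a \<times> 'a) pre_digraph set" where
  "connected_components P = pre_digraph.sccs (with_proj P)"

lemma group_SL: "group (SL :: ('a::field ^ 'n ^ 'n) monoid)"
proof (rule groupI)
  fix A :: "'a ^ 'n ^ 'n"
  assume A: "A \<in> carrier SL"
  then have "invertible A"
    by (simp add: SL_def invertible_det_nz)
  then obtain B where B: "A ** B = mat 1" "B ** A = mat 1"
    by (auto simp: invertible_def)
  then have "det B = 1"
    using A det_mul[of A B] by (simp add: SL_def)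
  with B show "\<exists>B\<in>carrier SL. B \<otimes>\<^bsub>SL\<^esub> A = \<one>\<^bsub>SL\<^esub>"
    by (auto simp: SL_def)
qed (auto simp: SL_def det_mul matrix_mul_assoc)

lemma (in group) normal_center: "center G \<lhd> G"
proof (rule normal_invI)
  show "subgroup (center G) G"
  proof (rule subgroupI)
    fix a assume a: "a \<in> center G"
    then have a' [simp]: "a \<in> carrier G" by (simp add: center_def)
    have "inv a \<otimes> x = x \<otimes> inv a" if x [simp]: "x \<in> carrier G" for x
    proof -
      have ax: "a \<otimes> x = x \<otimes> a" using a by (simp add: center_def)
      have "inv a \<otimes> x = inv a \<otimes> (x \<otimes> a \<otimes> inv a)"
        by (simp add: m_assoc)
      also have "\<dots> = inv a \<otimes> (a \<otimes> x \<otimes> inv a)"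
        by (simp only: ax)
      also have "\<dots> = inv a \<otimes> a \<otimes> (x \<otimes> inv a)"
        by (simp only: m_assoc a' x inv_closed m_closed)
      also have "\<dots> = x \<otimes> inv a"
        by simp
      finally show ?thesis .
    qed
    moreover have "inv a \<in> carrier G" by simp
    ultimately show "inv a \<in> center G" unfolding center_def by blast
  next
    fix a b assume ab: "a \<in> center G" "b \<in> center G"
    have "a \<otimes> b \<otimes> x = x \<otimes> (a \<otimes> b)" if x: "x \<in> carrier G" for x
    proof -
      have c: "a \<in> carrier G" "b \<in> carrier G" "a \<otimes> x = x \<otimes> a" "b \<otimes> x = x \<otimes> b"
        using ab x unfolding center_def by blast+
      have "a \<otimes> b \<otimes> x = a \<otimes> (x \<otimes> b)"
        using c x by (simp add: m_assoc)
      also have "\<dots> = a \<otimes> x \<otimes> b"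
        using c(1,2) x by (simp only: m_assoc)
      also have "\<dots> = x \<otimes> (a \<otimes> b)"
        unfolding c(3) using c(1,2) x by (simp only: m_assoc)
      finally show ?thesis .
    qed
    moreover have "a \<otimes> b \<in> carrier G" using ab unfolding center_def by blast
    ultimately show "a \<otimes> b \<in> center G" unfolding center_def by blast
  qed (auto simp: center_def)
next
  fix x h assume "x \<in> carrier G" "h \<in> center G"
  then have c: "x \<in> carrier G" "h \<in> carrier G" "x \<otimes> h = h \<otimes> x"
    unfolding center_def by simp_all
  then have "x \<otimes> h \<otimes> inv x = h"
    by (simp only: c(3)) (simp add: m_assoc)
  then show "x \<otimes> h \<otimes> inv x \<in> center G"
    using \<open>h \<in> center G\<close> by simp
qed

lemma group_PSL: "group (PSL :: ('a::field ^ 'n ^ 'n) set monoid)"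
  unfolding PSL_def by (intro normal.factorgroup_is_group group.normal_center group_SL)

lemma pair_graph_proper_power_graph:
  assumes "finite (carrier G)"
  shows "pair_graph (proper_power_graph G)"
proof
  show "finite (pverts (proper_power_graph G))"
    using assms by (simp add: proper_power_graph_def Let_def)
  show "finite (parcs (proper_power_graph G))"
    by (rule finite_subset[of _ "carrier G \<times> carrier G"])
       (use assms in \<open>auto simp: proper_power_graph_def Let_def\<close>)
qed (auto simp: proper_power_graph_def Let_def symmetric_def sym_def arcs_ends_def arc_to_ends_def)

end

theory Submission
  imports Defs "HOL-Number_Theory.Residues" "HOL-Algebra.Algebraic_Closure_Type"
begin

text \<open>Let \<open>q = p^n\<close>. Modulo scalar matrices, a power of \<open>A\<close> is a multiple of \<open>A\<close>, so the component of a
  non-trivial element of PSL(2,q) determines a point of the projective plane of 2 x 2 matrices modulo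
  scalars. The points whose discriminant does not vanish number \<open>q\<^sup>2\<close>. Each of them is represented in
  PSL(2,q) because \<open>q > 3\<close>, and its representatives lie in a cyclic group (the elements of
  determinant 1 of a quadratic algebra), so they form a single component. The remaining
  \<open>q\<^sup>2 - 1\<close> elements are the images of the unipotent matrices; they have order \<open>p\<close>, so their components
  are the subgroups of order \<open>p\<close> without the identity, each with \<open>p - 1\<close> elements. Altogether there
  are \<open>q\<^sup>2 + (q\<^sup>2 - 1) / (p - 1)\<close> components.\<close>

hide_const (open) Divisibility.prime
no_notation fps_nth (infixl \<open>$\<close> 75)
no_notation set_add (infixl \<open><+>\<index>\<close> 60)

section \<open>Power graphs\<close>

text \<open>\<open>\<Phi>\<close> is a complete invariant of the components: by \<open>pow\<close>
  it is constant along arcs, and by \<open>gen\<close> two vertices with equal label are joined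
  through a common root \<open>g\<close>. So the components are the nonempty fibres of
  \<open>\<Phi>\<close>.\<close>

lemma (in group) card_components_proper_power_graph:
  assumes fin: "finite (carrier G)"
    and pow: "\<And>x k::nat. x \<in> carrier G \<Longrightarrow> x [^] k \<noteq> \<one> \<Longrightarrow> \<Phi> (x [^] k) = \<Phi> x"
    and gen: "\<And>x y. x \<in> carrier G - {\<one>} \<Longrightarrow> y \<in> carrier G - {\<one>} \<Longrightarrow> \<Phi> x = \<Phi> y \<Longrightarrow>
      \<exists>g \<in> carrier G. \<exists>(i::nat) (j::nat). x = g [^] i \<and> y = g [^] j"
  shows "card (connected_components (proper_power_graph G)) = card (\<Phi> ` (carrier G - {\<one>}))"
proof -
  define V where "V = carrier G - {\<one>}"
  define P where "P = proper_power_graph G"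
  interpret P: pair_graph P
    unfolding P_def using fin by (rule pair_graph_proper_power_graph)
  have verts: "pverts P = V"
    by (simp add: P_def V_def proper_power_graph_def Let_def)
  have arcs: "(x, y) \<in> parcs P \<longleftrightarrow> x \<in> V \<and> y \<in> V \<and> x \<noteq> y \<and>
      ((\<exists>k::nat. y = x [^] k) \<or> (\<exists>k::nat. x = y [^] k))" for x y
    by (simp add: P_def V_def proper_power_graph_def Let_def)
  have arc_eq: "\<Phi> x = \<Phi> y" if "(x, y) \<in> parcs P" for x y
    using that pow unfolding arcs V_def by (metis DiffE singletonI)
  have reach_eq: "\<Phi> x = \<Phi> y" if "x \<rightarrow>\<^sup>*\<^bsub>with_proj P\<^esub> y" for x y
    using that
  proof (induction rule: P.reachable_induct)
    case (step x y)
    then show ?case using arc_eq by simp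
  qed simp
  have reach_pow: "g \<rightarrow>\<^sup>*\<^bsub>with_proj P\<^esub> (g [^] k)" "(g [^] k) \<rightarrow>\<^sup>*\<^bsub>with_proj P\<^esub> g"
    if "g \<in> V" "g [^] k \<in> V" for g and k :: nat
  proof -
    \<comment> \<open>Loops are excluded, so a power equal to \<open>g\<close> itself is reached
      only by the empty path.\<close>
    have "g = g [^] k \<or> (g, g [^] k) \<in> parcs P \<and> (g [^] k, g) \<in> parcs P"
      using that unfolding arcs by auto
    then show "g \<rightarrow>\<^sup>*\<^bsub>with_proj P\<^esub> (g [^] k)" "(g [^] k) \<rightarrow>\<^sup>*\<^bsub>with_proj P\<^esub> g"
      using that verts P.reachable_refl[of g] P.reachable_adjI by auto
  qed
  have reach: "x \<rightarrow>\<^sup>*\<^bsub>with_proj P\<^esub> y" if xy: "x \<in> V" "y \<in> V" and eq: "\<Phi> x = \<Phi> y" for x y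
  proof -
    have "\<exists>g \<in> carrier G. \<exists>(i::nat) (j::nat). x = g [^] i \<and> y = g [^] j"
      using xy eq unfolding V_def by (rule gen)
    then obtain g and i j :: nat where g: "g \<in> carrier G" "x = g [^] i" "y = g [^] j"
      by (elim bexE exE conjE)
    have "g \<noteq> \<one>"
      using xy(1) unfolding V_def g(2) by auto
    then have "g \<in> V"
      using g(1) unfolding V_def by simp
    then show ?thesis
      using reach_pow(2)[of g i] reach_pow(1)[of g j] xy unfolding g(2,3)
      by (blast intro: P.reachable_trans)
  qed
  have scc: "P.scc_of x = {y \<in> V. \<Phi> y = \<Phi> x}" if x: "x \<in> V" for x
  proof (intro Set.set_eqI iffI)
    fix y
    assume "y \<in> P.scc_of x"
    then have xy: "x \<rightarrow>\<^sup>*\<^bsub>with_proj P\<^esub> y"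
      unfolding P.scc_of_def by blast
    have "y \<in> pverts P"
      using P.reachable_in_verts(2)[OF xy] by simp
    with reach_eq[OF xy] show "y \<in> {y \<in> V. \<Phi> y = \<Phi> x}"
      unfolding verts by simp
  next
    fix y
    assume "y \<in> {y \<in> V. \<Phi> y = \<Phi> x}"
    then show "y \<in> P.scc_of x"
      unfolding P.scc_of_def using x reach[of x y] reach[of y x] by simp
  qed
  have "P.sccs_verts = (\<lambda>c. {y \<in> V. \<Phi> y = c}) ` \<Phi> ` V"
    unfolding P.sccs_verts_conv_scc_of with_proj_simps verts image_image
    using scc by (rule image_cong[OF refl])
  moreover have "inj_on (\<lambda>c. {y \<in> V. \<Phi> y = c}) (\<Phi> ` V)"
    by (auto simp: inj_on_def)
  ultimately have "card P.sccs_verts = card (\<Phi> ` V)"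
    by (simp add: card_image)
  then show ?thesis
    unfolding connected_components_def P_def[symmetric] V_def[symmetric] P.card_sccs_verts by simp
qed

section \<open>Cyclic groups\<close>

text \<open>The powers of one element \<open>a\<close> of order \<open>d\<close> already give
  \<open>d\<close> solutions of \<open>x^d = 1\<close>, hence all of them, and among these only the
  exponents coprime to \<open>d\<close> yield order \<open>d\<close>.\<close>

lemma (in group) card_ord_eq_le_totient:
  assumes fin: "finite (carrier G)" and "d > 0"
    and roots: "card {x \<in> carrier G. x [^] d = \<one>} \<le> d"
  shows "card {x \<in> carrier G. ord x = d} \<le> totient d"
proof (cases "{x \<in> carrier G. ord x = d} = {}")
  case False
  then obtain a where a: "a \<in> carrier G" "ord a = d"
    by auto
  \<comment> \<open>Exponents run from 1 to \<open>d\<close> rather than from 0 because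
    \<open>totatives d\<close> lies in that range.\<close>
  have inj: "inj_on (\<lambda>k::nat. a [^] k) {0<..d}"
    using ord_inj'[OF a(1)] unfolding a(2) by (simp add: atLeastSucAtMost_greaterThanAtMost[symmetric])
  have "(\<lambda>k::nat. a [^] k) ` {0<..d} = {x \<in> carrier G. x [^] d = \<one>}"
  proof (rule card_seteq)
    show "(\<lambda>k::nat. a [^] k) ` {0<..d} \<subseteq> {x \<in> carrier G. x [^] d = \<one>}"
      using a by (auto simp: pow_eq_id nat_pow_pow)
    show "card {x \<in> carrier G. x [^] d = \<one>} \<le> card ((\<lambda>k::nat. a [^] k) ` {0<..d})"
      using roots by (simp add: card_image[OF inj])
  qed (use fin in auto)
  then have "{x \<in> carrier G. ord x = d} \<subseteq> (\<lambda>k::nat. a [^] k) ` totatives d"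
    using pow_ord_eq_1 pow_ord_eq_ord_iff[OF fin a(1)] a(2)
    unfolding totatives_def by (smt (verit, best) image_iff mem_Collect_eq subsetI)
  then have "card {x \<in> carrier G. ord x = d} \<le> card ((\<lambda>k::nat. a [^] k) ` totatives d)"
    by (intro card_mono) auto
  also have "\<dots> \<le> totient d"
    unfolding totient_def by (intro card_image_le) simp
  finally show ?thesis .
qed (simp only: card.empty)

text \<open>Counting elements by order gives the same sum over the divisors of the group order
  \<open>N\<close> as the totients do. Termwise bounds then force equality in every term; the term
  at \<open>N\<close> is positive, so an element of order \<open>N\<close> exists.\<close>

lemma (in group) cyclic_if_few_roots_of_unity:
  assumes fin: "finite (carrier G)"
    and roots: "\<And>d. d > 0 \<Longrightarrow> card {x \<in> carrier G. x [^] (d::nat) = \<one>} \<le> d"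
  shows "\<exists>g \<in> carrier G. \<forall>x \<in> carrier G. \<exists>k::nat. x = g [^] k"
proof -
  let ?N = "Coset.order G" and ?c = "\<lambda>d. card {x \<in> carrier G. ord x = d}"
  have N: "?N > 0"
    using fin by (simp add: order_gt_0_iff_finite)
  have fin_divs: "finite {d. d dvd ?N}"
    using N by (rule finite_divisors_nat)
  have "?N = card (\<Union>d \<in> {d. d dvd ?N}. {x \<in> carrier G. ord x = d})"
    unfolding Coset.order_def
    by (rule arg_cong[where f = card]) (auto simp: ord_dvd_group_order[unfolded Coset.order_def])
  also have "\<dots> = (\<Sum>d | d dvd ?N. ?c d)"
    using fin_divs fin by (intro card_UN_disjoint) auto
  finally have sum: "(\<Sum>d | d dvd ?N. ?c d) = (\<Sum>d | d dvd ?N. totient d)"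
    by (simp add: totient_divisor_sum)
  have "?c ?N = totient ?N"
  proof (rule sum_mono_inv[OF sum])
    show "?c d \<le> totient d" if "d \<in> {d. d dvd ?N}" for d
      using that N fin roots by (intro card_ord_eq_le_totient) (auto intro: Nat.gr0I)
  qed (use fin_divs in auto)
  then have "?c ?N > 0"
    using N by simp
  then obtain g where g: "g \<in> carrier G" "ord g = ?N"
    by (auto simp: card_gt_0_iff)
  have "(\<lambda>k::nat. g [^] k) ` {0..ord g - 1} = carrier G"
    using g N fin card_image[OF ord_inj[OF g(1)]]
    by (intro card_subset_eq) (auto simp: Coset.order_def)
  then show ?thesis
    using g(1) by blast
qed

section \<open>Two by two matrices\<close>

definition mat2 :: "'a::zero \<Rightarrow> 'a \<Rightarrow> 'a \<Rightarrow> 'a \<Rightarrow> 'a ^ 2 ^ 2" where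
  "mat2 a b c d = vector [vector [a, b], vector [c, d]]"

lemma mat2_nth [simp]:
  "mat2 a b c d $ 1 $ 1 = a" "mat2 a b c d $ 1 $ 2 = b"
  "mat2 a b c d $ 2 $ 1 = c" "mat2 a b c d $ 2 $ 2 = d"
  by (simp_all add: mat2_def)

lemma mat2_eq_iff [simp]:
  "mat2 a b c d = mat2 a' b' c' d' \<longleftrightarrow> a = a' \<and> b = b' \<and> c = c' \<and> d = d'"
  by (metis mat2_nth)

lemma mat2_eta: "mat2 (A $ 1 $ 1) (A $ 1 $ 2) (A $ 2 $ 1) (A $ 2 $ 2) = A"
  by (simp add: vec_eq_iff forall_2)

lemma mat2_cases [cases type]: obtains a b c d where "A = mat2 a b c d"
  using mat2_eta[of A] by metis

lemma mat2_mult [simp]: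
  "mat2 a b c d ** mat2 a' b' c' d' =
    mat2 (a * a' + b * c') (a * b' + b * d') (c * a' + d * c') (c * b' + d * d')"
  by (simp add: vec_eq_iff forall_2 matrix_matrix_mult_def sum_2)

lemma det_mat2 [simp]: "det (mat2 a b c d) = a * d - b * c"
  by (simp add: det_2)

lemma mat_1_eq_mat2: "mat 1 = mat2 1 0 0 1"
  by (simp add: vec_eq_iff forall_2 mat_def)

lemma uminus_mat2 [simp]: "- mat2 a b c d = mat2 (-a) (-b) (-c) (- d :: 'a::group_add)"
  by (simp add: vec_eq_iff forall_2)

definition tr2 :: "'a::field ^ 2 ^ 2 \<Rightarrow> 'a" where
  "tr2 A = A $ 1 $ 1 + A $ 2 $ 2"

lemma tr2_mat2 [simp]: "tr2 (mat2 a b c d) = a + d"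
  by (simp add: tr2_def)

text \<open>The element \<open>x * I + y * A\<close> of the commutative algebra generated by
  \<open>A\<close>.\<close>

definition lincomb :: "'a::field ^ 2 ^ 2 \<Rightarrow> 'a \<Rightarrow> 'a \<Rightarrow> 'a ^ 2 ^ 2" where
  "lincomb A x y = mat2 (x + y * A $ 1 $ 1) (y * A $ 1 $ 2) (y * A $ 2 $ 1) (x + y * A $ 2 $ 2)"

text \<open>Cayley-Hamilton: the square of \<open>A\<close> is
  \<open>tr2 A * A - det A * I\<close>.\<close>

lemma lincomb_mult:
  "lincomb A x y ** lincomb A x' y' =
    lincomb A (x * x' - y * y' * det A) (x * y' + x' * y + y * y' * tr2 A)"
  by (cases A) (simp add: lincomb_def algebra_simps)

lemma det_lincomb: "det (lincomb A x y) = x\<^sup>2 + x * y * tr2 A + y\<^sup>2 * det A"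
  by (cases A) (simp add: lincomb_def algebra_simps power2_eq_square)

lemma lincomb_1_0: "lincomb A 1 0 = mat 1"
  by (simp add: lincomb_def mat_1_eq_mat2)

lemma lincomb_0_1: "lincomb A 0 1 = A"
  by (cases A) (simp add: lincomb_def)

text \<open>\<open>dir A\<close> stands for \<open>A\<close> modulo scalar matrices; \<open>disc (dir A)\<close> is the discriminant of the
  characteristic polynomial of \<open>A\<close>. A \<open>line\<close> does not contain the origin.\<close>

definition dir :: "'a::field ^ 2 ^ 2 \<Rightarrow> 'a \<times> 'a \<times> 'a" where
  "dir A = (A $ 1 $ 2, A $ 2 $ 1, A $ 2 $ 2 - A $ 1 $ 1)"

fun scale :: "'a::field \<Rightarrow> 'a \<times> 'a \<times> 'a \<Rightarrow> 'a \<times> 'a \<times> 'a" where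
  "scale s (b, c, e) = (s * b, s * c, s * e)"

fun disc :: "'a::field \<times> 'a \<times> 'a \<Rightarrow> 'a" where
  "disc (b, c, e) = e\<^sup>2 + 4 * b * c"

definition line :: "'a::field \<times> 'a \<times> 'a \<Rightarrow> ('a \<times> 'a \<times> 'a) set" where
  "line v = {scale s v | s. s \<noteq> 0}"

lemma dir_mat2 [simp]: "dir (mat2 a b c d) = (b, c, d - a)"
  by (simp add: dir_def)

lemma scale_scale [simp]: "scale s (scale r v) = scale (s * r) v"
  by (cases v) simp

lemma scale_1 [simp]: "scale 1 v = v"
  by (cases v) simp

lemma scale_0 [simp]: "scale 0 v = (0, 0, 0)"
  by (cases v) simp

lemma scale_eq_iff:
  "v \<noteq> (0, 0, 0) \<Longrightarrow> scale s v = scale r v \<longleftrightarrow> s = r"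
  by (cases v) auto

lemma disc_scale [simp]: "disc (scale s v) = s\<^sup>2 * disc v"
  by (cases v) (simp add: algebra_simps power2_eq_square)

lemma disc_dir: "disc (dir A) = (tr2 A)\<^sup>2 - 4 * det A"
  by (cases A) (simp add: algebra_simps power2_eq_square)

lemma dir_uminus: "dir (- A) = scale (-1) (dir A)"
  by (cases A) simp

lemma dir_lincomb [simp]: "dir (lincomb A x y) = scale y (dir A)"
  by (cases A) (simp add: lincomb_def algebra_simps)

lemma lincomb_eq_iff:
  assumes "dir A \<noteq> (0, 0, 0)"
  shows "lincomb A x y = lincomb A x' y' \<longleftrightarrow> x = x' \<and> y = y'"
proof
  assume eq: "lincomb A x y = lincomb A x' y'"
  then have "scale y (dir A) = scale y' (dir A)"
    by (metis dir_lincomb)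
  then have "y = y'"
    using assms by (simp add: scale_eq_iff)
  with eq show "x = x' \<and> y = y'"
    by (simp add: lincomb_def)
qed simp

lemma dir_eq_scaleE:
  assumes "dir B = scale s (dir A)"
  obtains x where "B = lincomb A x s"
proof
  show "B = lincomb A (B $ 1 $ 1 - s * A $ 1 $ 1) s"
    using assms by (cases A; cases B) (simp add: lincomb_def algebra_simps)
qed

lemma line_scale: "s \<noteq> 0 \<Longrightarrow> line (scale s v) = line v"
proof -
  assume s: "s \<noteq> 0"
  have "scale r v \<in> line (scale s v)" if "r \<noteq> 0" for r
    using s that unfolding line_def by (auto intro!: exI[of _ "r / s"])
  then show ?thesis
    using s unfolding line_def by auto
qed

lemma self_in_line: "v \<in> line v"
  unfolding line_def by (auto intro!: exI[of _ 1])

section \<open>The group SL(2)\<close>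

lemma SL_simps [simp]:
  "A \<in> carrier SL \<longleftrightarrow> det A = 1" "A \<otimes>\<^bsub>SL\<^esub> B = A ** B" "\<one>\<^bsub>SL\<^esub> = mat 1"
  by (simp_all add: SL_def)

interpretation SL: group "SL :: ('a::field ^ 'n ^ 'n) monoid"
  by (rule group_SL)

text \<open>A vanishing direction means a scalar matrix, and a scalar of determinant 1 has square
  1.\<close>

lemma dir_eq_0_iff:
  assumes "det A = 1"
  shows "dir A = (0, 0, 0) \<longleftrightarrow> A = mat 1 \<or> A = - mat 1"
  using assms by (cases A) (auto simp: mat_1_eq_mat2 square_eq_1_iff)

lemma center_SL2: "center (SL :: ('a::field ^ 2 ^ 2) monoid) = {mat 1, - mat 1}"
proof
  show "center (SL :: ('a::field ^ 2 ^ 2) monoid) \<subseteq> {mat 1, - mat 1}"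
  proof
    fix A :: "'a ^ 2 ^ 2"
    assume "A \<in> center SL"
    then have A: "det A = 1" and comm: "\<And>B. det B = 1 \<Longrightarrow> A ** B = B ** A"
      by (auto simp: center_def)
    \<comment> \<open>Commuting with the upper transvection kills the lower left entry and equalises
      the diagonal; the lower transvection kills the remaining entry.\<close>
    have "dir A = (0, 0, 0)"
      using comm[of "mat2 1 1 0 1"] comm[of "mat2 1 0 1 1"] by (cases A) auto
    then show "A \<in> {mat 1, - mat 1}"
      using dir_eq_0_iff[OF A] by simp
  qed
  have "A ** - mat 1 = - A" "- mat 1 ** A = - A" for A :: "'a ^ 2 ^ 2"
    by (cases A; simp add: mat_1_eq_mat2)+
  then show "{mat 1, - mat 1} \<subseteq> center (SL :: ('a::field ^ 2 ^ 2) monoid)"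
    by (auto simp: center_def) (simp add: mat_1_eq_mat2)
qed

lemma SL2_pow_lincomb:
  assumes "det A = 1"
  shows "\<exists>x y. A [^]\<^bsub>SL\<^esub> (k::nat) = lincomb A x y"
proof (induction k)
  case 0
  show ?case
    by (metis SL_simps(3) SL.nat_pow_0 lincomb_1_0)
next
  case (Suc k)
  then obtain x y where "A [^]\<^bsub>SL\<^esub> k = lincomb A x y"
    by blast
  then have "A [^]\<^bsub>SL\<^esub> Suc k = lincomb A x y ** lincomb A 0 1"
    by (simp add: lincomb_0_1)
  then show ?case
    unfolding lincomb_mult by blast
qed

section \<open>Cyclicity of the determinant-one elements of a quadratic algebra\<close>

lemma card_roots_of_unity_le:
  assumes "d > 0"
  shows "card {z :: 'a::field. z ^ d = 1} \<le> d"
proof -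
  let ?p = "monom 1 d - 1 :: 'a poly"
  have "coeff ?p d = 1"
    using assms by simp
  then have "?p \<noteq> 0"
    by (metis coeff_0 zero_neq_one)
  have "card {z :: 'a. z ^ d = 1} = card {z. poly ?p z = 0}"
    by (simp add: poly_monom)
  also have "\<dots> \<le> degree ?p"
    using \<open>?p \<noteq> 0\<close> by (rule card_poly_roots_bound)
  also have "\<dots> \<le> d"
    by (rule degree_diff_le) (simp_all add: degree_monom_le)
  finally show ?thesis .
qed

text \<open>The algebra spanned by \<open>A\<close> has two distinct homomorphisms to an algebraic closure, sending
  \<open>A\<close> to its eigenvalues \<open>l\<close> and \<open>m\<close>. On elements of determinant \<open>1\<close> either of them determines
  the other, so it is injective there.\<close>

lemma SL2_embedding:
  fixes A :: "'a::field ^ 2 ^ 2"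
  assumes A: "det A = 1" "disc (dir A) \<noteq> 0"
  obtains \<phi> :: "'a ^ 2 ^ 2 \<Rightarrow> 'a alg_closure"
  where "inj_on \<phi> {B. det B = 1 \<and> (\<exists>x y. B = lincomb A x y)}"
    and "\<phi> (mat 1) = 1"
    and "\<And>x y x' y'. \<phi> (lincomb A x y ** lincomb A x' y') = \<phi> (lincomb A x y) * \<phi> (lincomb A x' y')"
proof -
  let ?t = "to_ac (tr2 A)"
  have "degree [:1, - ?t, 1:] > 0"
    by simp
  then obtain l where "poly [:1, - ?t, 1:] l = 0"
    using alg_closed_imp_poly_has_root by blast
  then have l: "l * l = ?t * l - 1"
    by (simp add: algebra_simps)
  define m where "m = ?t - l"
  have lm: "l * m = 1" "l + m = ?t"
    using l by (simp_all add: m_def algebra_simps)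
  \<comment> \<open>The squared difference of the eigenvalues is the discriminant, so they are
    distinct.\<close>
  have "(l - m)\<^sup>2 = (l + m)\<^sup>2 - 4 * (l * m)"
    by (simp add: power2_eq_square algebra_simps)
  also have "\<dots> = to_ac (disc (dir A))"
    using A(1) by (simp add: lm disc_dir)
  finally have "l \<noteq> m"
    using A(2) by auto
  have dir: "dir A \<noteq> (0, 0, 0)"
    using A(2) by auto
  \<comment> \<open>Evaluation at the eigenvalue \<open>l\<close>. It is well defined on the algebra
    because \<open>A\<close> is not scalar, so coordinates are unique; elsewhere the value is
    unspecified.\<close>
  define \<phi> where "\<phi> B = (THE z. \<exists>x y. B = lincomb A x y \<and> z = to_ac x + to_ac y * l)" for B
  have \<phi>: "\<phi> (lincomb A x y) = to_ac x + to_ac y * l" for x y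
    unfolding \<phi>_def using lincomb_eq_iff[OF dir] by (intro the_equality) auto
  show thesis
  proof
    show "inj_on \<phi> {B. det B = 1 \<and> (\<exists>x y. B = lincomb A x y)}"
    proof (rule inj_onI, clarsimp)
      fix x y x' y'
      let ?u = "to_ac x + to_ac y * l" and ?u' = "to_ac x' + to_ac y' * l"
      let ?v = "to_ac x + to_ac y * m" and ?v' = "to_ac x' + to_ac y' * m"
      assume d: "det (lincomb A x y) = 1" "det (lincomb A x' y') = 1"
        and eq: "\<phi> (lincomb A x y) = \<phi> (lincomb A x' y')"
      \<comment> \<open>The product of the two conjugate values is the norm, which is the
        determinant.\<close>
      have uv: "(to_ac a + to_ac b * l) * (to_ac a + to_ac b * m) = 1"
        if "det (lincomb A a b) = 1" for a b
      proof -
        have "(to_ac a + to_ac b * l) * (to_ac a + to_ac b * m) =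
            (to_ac a)\<^sup>2 + to_ac a * to_ac b * (l + m) + (to_ac b)\<^sup>2 * (l * m)"
          by (simp add: power2_eq_square algebra_simps)
        also have "\<dots> = to_ac (det (lincomb A a b))"
          by (simp add: lm det_lincomb A(1))
        finally show ?thesis
          using that by simp
      qed
      have u: "?u = ?u'"
        using eq by (simp add: \<phi>)
      have "?v = ?v'"
        using uv[OF d(1)] uv[OF d(2)] u by (metis mult_cancel_left zero_neq_one mult_zero_left)
      have "(to_ac y - to_ac y') * (l - m) = (?u - ?u') - (?v - ?v')"
        by (simp add: algebra_simps)
      also have "\<dots> = 0"
        using u \<open>?v = ?v'\<close> by simp
      finally have "y = y'"
        using \<open>l \<noteq> m\<close> by simp
      moreover have "x = x'"
        using u \<open>y = y'\<close> by simp
      ultimately show "lincomb A x y = lincomb A x' y'"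
        by simp
    qed
    show "\<phi> (mat 1) = 1"
      using \<phi>[of 1 0] by (simp add: lincomb_1_0)
    show "\<phi> (lincomb A x y ** lincomb A x' y') = \<phi> (lincomb A x y) * \<phi> (lincomb A x' y')"
      for x y x' y'
    proof -
      have "\<phi> (lincomb A x y) * \<phi> (lincomb A x' y') =
          to_ac x * to_ac x' + (to_ac x * to_ac y' + to_ac x' * to_ac y) * l + to_ac y * to_ac y' * (l * l)"
        by (simp add: \<phi> algebra_simps)
      also have "\<dots> = \<phi> (lincomb A x y ** lincomb A x' y')"
        unfolding l by (simp add: \<phi> lincomb_mult A(1) algebra_simps)
      finally show ?thesis ..
    qed
  qed
qed

text \<open>The determinant-one elements of the algebra of \<open>A\<close> form a finite group that
  embeds into the units of a field, so few roots of unity make it cyclic. It contains every such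
  \<open>B\<close>, because \<open>B - s * A\<close> is scalar.\<close>

lemma SL2_cyclic:
  fixes A :: "'a::{field, finite} ^ 2 ^ 2"
  assumes A: "det A = 1" "disc (dir A) \<noteq> 0"
  shows "\<exists>g. det g = 1 \<and> (\<forall>B s. det B = 1 \<longrightarrow> dir B = scale s (dir A) \<longrightarrow> (\<exists>k::nat. B = g [^]\<^bsub>SL\<^esub> k))"
proof -
  define N where "N = {B. det B = 1 \<and> (\<exists>x y. B = lincomb A x y)}"
  have "subgroup N SL"
  proof (rule SL.subgroupI)
    show "N \<subseteq> carrier SL" "N \<noteq> {}"
      unfolding N_def using A(1) lincomb_0_1[of A] by (auto, metis)
    show "B \<otimes>\<^bsub>SL\<^esub> C \<in> N" if "B \<in> N" "C \<in> N" for B C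
      using that unfolding N_def by (auto simp: det_mul) (metis lincomb_mult)
    show "inv\<^bsub>SL\<^esub> B \<in> N" if B: "B \<in> N" for B
    proof -
      obtain x y where xy: "det B = 1" "B = lincomb A x y"
        using B unfolding N_def by blast
      \<comment> \<open>The conjugate of \<open>B\<close>, obtained by replacing \<open>A\<close>
        with \<open>tr2 A * I - A\<close>; its product with \<open>B\<close> is the norm of
        \<open>B\<close>.\<close>
      define C where "C = lincomb A (x + y * tr2 A) (- y)"
      have "det C = 1"
        using xy by (simp add: C_def det_lincomb A(1) power2_eq_square algebra_simps)
      have "C ** B = lincomb A (det B) 0"
        unfolding xy(2) det_lincomb C_def lincomb_mult
        by (simp add: A(1) power2_eq_square algebra_simps)
      then have "C ** B = mat 1"
        using xy(1) by (simp add: lincomb_1_0)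
      then have "inv\<^bsub>SL\<^esub> B = C"
        using xy \<open>det C = 1\<close> by (intro SL.inv_equality) auto
      then show ?thesis
        unfolding N_def using \<open>det C = 1\<close> C_def by auto
    qed
  qed
  define H where "H = (SL :: ('a ^ 2 ^ 2) monoid)\<lparr>carrier := N\<rparr>"
  interpret H: group H
    unfolding H_def using \<open>subgroup N SL\<close> by (rule SL.subgroup_imp_group)
  have H [simp]: "carrier H = N" "\<one>\<^bsub>H\<^esub> = mat 1"
    by (simp_all add: H_def)
  have pow_H: "x [^]\<^bsub>H\<^esub> (k::nat) = x [^]\<^bsub>SL\<^esub> k" for x k
    unfolding H_def by (rule SL.nat_pow_consistent[symmetric])
  obtain \<phi> :: "'a ^ 2 ^ 2 \<Rightarrow> 'a alg_closure"
    where inj: "inj_on \<phi> N" and \<phi>_1: "\<phi> (mat 1) = 1"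
      and \<phi>_mult: "\<And>x y x' y'. \<phi> (lincomb A x y ** lincomb A x' y') =
        \<phi> (lincomb A x y) * \<phi> (lincomb A x' y')"
    using SL2_embedding[OF A, folded N_def] by blast
  have \<phi>_pow: "\<phi> (B [^]\<^bsub>H\<^esub> (k::nat)) = \<phi> B ^ k" if "B \<in> N" for B k
  proof (induction k)
    case (Suc k)
    have "B [^]\<^bsub>H\<^esub> k \<in> N"
      using that H.nat_pow_closed[of B k] by simp
    then have "\<phi> (B [^]\<^bsub>H\<^esub> k ** B) = \<phi> (B [^]\<^bsub>H\<^esub> k) * \<phi> B"
      using that \<phi>_mult unfolding N_def by auto
    then show ?case
      using Suc.IH by (simp add: H_def mult.commute)
  qed (simp add: \<phi>_1)
  have "\<exists>g \<in> carrier H. \<forall>x \<in> carrier H. \<exists>k::nat. x = g [^]\<^bsub>H\<^esub> k"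
  proof (rule H.cyclic_if_few_roots_of_unity)
    fix d :: nat
    assume "d > 0"
    have fin: "finite {z :: 'a alg_closure. z ^ d = 1}"
      using poly_roots_finite[of "monom 1 d - 1 :: 'a alg_closure poly"] \<open>d > 0\<close>
      by (auto simp: poly_monom monom_eq_1_iff)
    have "card {x \<in> carrier H. x [^]\<^bsub>H\<^esub> d = \<one>\<^bsub>H\<^esub>} \<le> card {z :: 'a alg_closure. z ^ d = 1}"
    proof (rule card_inj_on_le[of \<phi>])
      show "inj_on \<phi> {x \<in> carrier H. x [^]\<^bsub>H\<^esub> d = \<one>\<^bsub>H\<^esub>}"
        using inj by (rule inj_on_subset) auto
      show "\<phi> ` {x \<in> carrier H. x [^]\<^bsub>H\<^esub> d = \<one>\<^bsub>H\<^esub>} \<subseteq> {z. z ^ d = 1}"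
        using \<phi>_pow \<phi>_1 by (auto simp flip: \<phi>_pow)
    qed (rule fin)
    then show "card {x \<in> carrier H. x [^]\<^bsub>H\<^esub> d = \<one>\<^bsub>H\<^esub>} \<le> d"
      using card_roots_of_unity_le[OF \<open>d > 0\<close>] by (rule order.trans)
  qed simp
  then obtain g where g: "g \<in> N" "\<And>x. x \<in> N \<Longrightarrow> \<exists>k::nat. x = g [^]\<^bsub>SL\<^esub> k"
    unfolding pow_H by auto
  have "\<exists>k::nat. B = g [^]\<^bsub>SL\<^esub> k" if "det B = 1" "dir B = scale s (dir A)" for B s
    using that by (intro g(2)) (auto simp: N_def elim: dir_eq_scaleE)
  with g(1) show ?thesis
    unfolding N_def by blast
qed

section \<open>Cyclic subgroups of prime order\<close>

text \<open>For \<open>x\<close> of finite order, the cyclic subgroup generated by \<open>x\<close>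
  without the identity.\<close>

definition nontrivial_powers :: "('a, 'b) monoid_scheme \<Rightarrow> 'a \<Rightarrow> 'a set" where
  "nontrivial_powers G x = {x [^]\<^bsub>G\<^esub> k | k::nat. True} - {\<one>\<^bsub>G\<^esub>}"

lemma (in group) self_in_nontrivial_powers:
  "x \<in> carrier G \<Longrightarrow> x \<noteq> \<one> \<Longrightarrow> x \<in> nontrivial_powers G x"
  unfolding nontrivial_powers_def by (auto intro!: exI[of _ "1::nat"])

lemma (in group) card_nontrivial_powers:
  assumes fin: "finite (carrier G)" and x: "x \<in> carrier G" "x \<noteq> \<one>"
    and p: "prime (p::nat)" "x [^] p = \<one>"
  shows "card (nontrivial_powers G x) = p - 1"
proof -
  have "ord x dvd p"
    using p(2) x(1) by (simp add: pow_eq_id)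
  then have ord: "ord x = p"
    using p(1) x ord_eq_1 by (auto simp: prime_nat_iff)
  have "{x [^] k | k::nat. True} = (\<lambda>k. x [^] k) ` {0..p - 1}"
    using ord_elems[OF fin x(1)] unfolding ord by auto
  moreover have "card ((\<lambda>k. x [^] k) ` {0..p - 1}) = p"
    using ord_inj[OF x(1)] prime_gt_0_nat[OF p(1)] unfolding ord by (simp add: card_image)
  moreover have "\<one> \<in> {x [^] k | k::nat. True}"
    by (auto intro!: exI[of _ "0::nat"])
  ultimately show ?thesis
    unfolding nontrivial_powers_def by simp
qed

text \<open>A nontrivial power of \<open>x\<close> again has order \<open>p\<close>; one inclusion
  is clear, and both sets have \<open>p - 1\<close> elements.\<close>

lemma (in group) nontrivial_powers_eq:
  assumes fin: "finite (carrier G)" and x: "x \<in> carrier G"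
    and p: "prime (p::nat)" "x [^] p = \<one>"
    and y: "y \<in> nontrivial_powers G x"
  shows "nontrivial_powers G y = nontrivial_powers G x"
proof (rule card_subset_eq)
  obtain k :: nat where k: "y = x [^] k" "y \<noteq> \<one>"
    using y unfolding nontrivial_powers_def by auto
  then show "nontrivial_powers G y \<subseteq> nontrivial_powers G x"
    using x unfolding nontrivial_powers_def by (auto simp: nat_pow_pow)
  have "nontrivial_powers G x \<subseteq> carrier G"
    using x unfolding nontrivial_powers_def by auto
  then show "finite (nontrivial_powers G x)"
    using fin finite_subset by blast
  have "y [^] p = (x [^] p) [^] k"
    using k x by (simp add: nat_pow_pow mult.commute)
  then have "y [^] p = \<one>"
    using p by simp
  moreover have "x \<noteq> \<one>" "y \<in> carrier G"
    using k x by auto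
  ultimately show "card (nontrivial_powers G y) = card (nontrivial_powers G x)"
    using k(2) x p fin by (simp add: card_nontrivial_powers)
qed

section \<open>The group PSL(2)\<close>

abbreviation proj :: "'a::field ^ 2 ^ 2 \<Rightarrow> ('a ^ 2 ^ 2) set" where
  "proj A \<equiv> center SL #>\<^bsub>SL\<^esub> A"

interpretation PSL: group "PSL :: ('a::field ^ 'n ^ 'n) set monoid"
  by (rule group_PSL)

lemma uminus_mat_1_mult [simp]: "- mat 1 ** A = - A" for A :: "'a::field ^ 2 ^ 2"
  by (cases A) (simp add: mat_1_eq_mat2)

lemma proj_eq: "proj A = {A, - A}"
  by (auto simp: r_coset_def center_SL2)

lemma tr2_uminus: "tr2 (- A) = - tr2 A"
  by (cases A) simp

lemma det_uminus_2 [simp]: "det (- A) = det A" for A :: "'a::field ^ 2 ^ 2"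
  by (cases A) simp

lemma proj_eq_iff: "proj A = proj B \<longleftrightarrow> A = B \<or> A = - B"
  unfolding proj_eq by (metis doubleton_eq_iff minus_minus insertCI)

lemma carrier_PSL: "carrier PSL = proj ` {A. det A = 1}"
  unfolding PSL_def carrier_FactGroup by (simp add: SL_def)

lemma one_PSL: "\<one>\<^bsub>PSL\<^esub> = proj (mat 1)"
  unfolding PSL_def proj_eq by (simp add: center_SL2)

lemma proj_eq_one_iff: "det A = 1 \<Longrightarrow> proj A = \<one>\<^bsub>PSL\<^esub> \<longleftrightarrow> dir A = (0, 0, 0)"
  by (simp add: one_PSL proj_eq_iff dir_eq_0_iff)

lemma pow_PSL: "det A = 1 \<Longrightarrow> proj A [^]\<^bsub>PSL\<^esub> (k::nat) = proj (A [^]\<^bsub>SL\<^esub> k)"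
  unfolding PSL_def by (intro normal.FactGroup_pow SL.normal_center) simp

lemma det_pow_SL: "det A = 1 \<Longrightarrow> det (A [^]\<^bsub>SL\<^esub> (k::nat)) = 1"
  using SL.nat_pow_closed[of A k] by simp

section \<open>Component labels and their behaviour under powers\<close>

lemma dir_pow_SL:
  assumes "det A = 1"
  obtains s where "dir (A [^]\<^bsub>SL\<^esub> (k::nat)) = scale s (dir A)"
  using SL2_pow_lincomb[OF assms, of k] by (metis dir_lincomb)

text \<open>The argument is a coset consisting of \<open>A\<close> and \<open>- A\<close>. Both have
  the same line and the same discriminant, so the union is just the line of either one.
  \<open>Inl\<close> labels are points of the projective plane; the sum type keeps the two kinds of
  components apart.\<close>

definition component_label ::
    "('a::field ^ 2 ^ 2) set \<Rightarrow> ('a \<times> 'a \<times> 'a) set + ('a ^ 2 ^ 2) set set" where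
  "component_label Y = (if \<exists>A \<in> Y. disc (dir A) \<noteq> 0 then Inl (\<Union>A \<in> Y. line (dir A))
     else Inr (nontrivial_powers PSL Y))"

lemma component_label_semisimple:
  "disc (dir A) \<noteq> 0 \<Longrightarrow> component_label (proj A) = Inl (line (dir A))"
  by (simp add: component_label_def proj_eq dir_uminus line_scale)

lemma component_label_unipotent:
  "disc (dir A) = 0 \<Longrightarrow> component_label (proj A) = Inr (nontrivial_powers PSL (proj A))"
  by (simp add: component_label_def proj_eq dir_uminus)

text \<open>With \<open>A = I + N\<close>, Cayley-Hamilton gives \<open>N ** N = 0\<close>, so the
  power is \<open>I + k * N\<close>.\<close>

lemma unipotent_pow:
  assumes "det A = 1" "tr2 A = 2"
  shows "A [^]\<^bsub>SL\<^esub> (k::nat) = lincomb A (1 - of_nat k) (of_nat k)"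
proof (induction k)
  case (Suc k)
  have "A [^]\<^bsub>SL\<^esub> Suc k = lincomb A (1 - of_nat k) (of_nat k) ** lincomb A 0 1"
    using Suc by (simp add: lincomb_0_1)
  also have "\<dots> = lincomb A (1 - of_nat (Suc k)) (of_nat (Suc k))"
    unfolding lincomb_mult by (simp add: assms algebra_simps)
  finally show ?case .
qed (simp add: lincomb_1_0)

text \<open>The discriminant factors as \<open>(tr2 A - 2) * (tr2 A + 2)\<close>, and a change of
  sign turns trace \<open>-2\<close> into trace \<open>2\<close>.\<close>

lemma disc_eq_0_trace:
  assumes "det A = 1" "disc (dir A) = 0"
  obtains B where "det B = 1" "tr2 B = 2" "proj B = proj A"
proof -
  have "(tr2 A - 2) * (tr2 A + 2) = 0"
    using assms by (simp add: disc_dir power2_eq_square algebra_simps)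
  then have "tr2 A = 2 \<or> tr2 A = - 2"
    by (simp add: eq_neg_iff_add_eq_0)
  then have "tr2 A = 2 \<or> tr2 (- A) = 2"
    by (auto simp: tr2_uminus)
  then show thesis
    using that[of A] that[of "- A"] assms(1) by (auto simp: proj_eq_iff)
qed

lemma unipotent_pow_eq_one:
  assumes A: "det A = 1" "disc (dir A) = 0" and p: "of_nat p = (0::'a)"
  shows "proj (A :: 'a::field ^ 2 ^ 2) [^]\<^bsub>PSL\<^esub> p = \<one>\<^bsub>PSL\<^esub>"
proof -
  obtain B where B: "det B = 1" "tr2 B = 2" "proj B = proj A"
    using disc_eq_0_trace[OF A] .
  have "B [^]\<^bsub>SL\<^esub> p = mat 1"
    using unipotent_pow[OF B(1,2), of p] p by (simp add: lincomb_1_0)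
  then show ?thesis
    using pow_PSL[OF B(1), of p] B(3) by (simp add: one_PSL)
qed

text \<open>A nontrivial power rescales the direction by a nonzero factor \<open>s\<close>, which
  preserves the line. If the discriminant vanishes, \<open>x\<close> has order \<open>p\<close>, so
  any nontrivial power generates the same subgroup.\<close>

lemma component_label_pow:
  fixes x :: "('a::{field, finite} ^ 2 ^ 2) set" and k :: nat
  assumes p: "prime p" "of_nat p = (0::'a)"
    and x: "x \<in> carrier PSL" "x [^]\<^bsub>PSL\<^esub> k \<noteq> \<one>\<^bsub>PSL\<^esub>"
  shows "component_label (x [^]\<^bsub>PSL\<^esub> k) = component_label x"
proof -
  obtain A where A: "det A = 1" "x = proj A"
    using x(1) unfolding carrier_PSL by blast
  obtain s where s: "dir (A [^]\<^bsub>SL\<^esub> k) = scale s (dir A)"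
    using dir_pow_SL[OF A(1)] .
  have pow: "x [^]\<^bsub>PSL\<^esub> k = proj (A [^]\<^bsub>SL\<^esub> k)"
    using A pow_PSL by blast
  have "dir (A [^]\<^bsub>SL\<^esub> k) \<noteq> (0, 0, 0)"
    using x(2) proj_eq_one_iff[OF det_pow_SL[OF A(1)], of k] unfolding pow by blast
  then have "s \<noteq> 0"
    unfolding s by auto
  show ?thesis
  proof (cases "disc (dir A) = 0")
    case True
    then have "disc (dir (A [^]\<^bsub>SL\<^esub> k)) = 0"
      by (simp add: s)
    moreover have "x [^]\<^bsub>PSL\<^esub> k \<in> nontrivial_powers PSL x"
      unfolding nontrivial_powers_def using x(2) by blast
    then have "nontrivial_powers PSL (x [^]\<^bsub>PSL\<^esub> k) = nontrivial_powers PSL x"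
      using unipotent_pow_eq_one[OF A(1) True p(2)] x(1) p(1)
      by (intro PSL.nontrivial_powers_eq[of _ p]) (simp_all add: A(2))
    ultimately show ?thesis
      using component_label_unipotent True A(2) pow by metis
  next
    case False
    then have "disc (dir (A [^]\<^bsub>SL\<^esub> k)) \<noteq> 0"
      using \<open>s \<noteq> 0\<close> by (simp add: s)
    then have "component_label (x [^]\<^bsub>PSL\<^esub> k) = Inl (line (dir A))"
      unfolding pow by (simp add: component_label_semisimple s line_scale[OF \<open>s \<noteq> 0\<close>])
    then show ?thesis
      unfolding A(2) component_label_semisimple[OF False] .
  qed
qed

text \<open>With vanishing discriminant, \<open>y\<close> itself is the common root. Otherwise it is
  the class of a generator of the cyclic group attached to the shared direction.\<close>

lemma component_label_eqD:
  fixes x y :: "('a::{field, finite} ^ 2 ^ 2) set"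
  assumes x: "x \<in> carrier PSL - {\<one>\<^bsub>PSL\<^esub>}" and y: "y \<in> carrier PSL - {\<one>\<^bsub>PSL\<^esub>}"
    and eq: "component_label x = component_label y"
  shows "\<exists>g \<in> carrier PSL. \<exists>(i::nat) (j::nat). x = g [^]\<^bsub>PSL\<^esub> i \<and> y = g [^]\<^bsub>PSL\<^esub> j"
proof -
  obtain A where A: "det A = 1" "x = proj A"
    using x unfolding carrier_PSL by blast
  obtain B where B: "det B = 1" "y = proj B"
    using y unfolding carrier_PSL by blast
  show ?thesis
  proof (cases "disc (dir A) = 0")
    case True
    have "disc (dir B) = 0"
    proof (rule ccontr)
      assume "disc (dir B) \<noteq> 0"
      then show False
        using eq True by (simp add: A B component_label_semisimple component_label_unipotent)
    qed
    then have "nontrivial_powers PSL x = nontrivial_powers PSL y"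
      using eq True by (simp add: A B component_label_unipotent)
    then have "x \<in> nontrivial_powers PSL y"
      using x PSL.self_in_nontrivial_powers by blast
    then obtain i :: nat where "x = y [^]\<^bsub>PSL\<^esub> i"
      unfolding nontrivial_powers_def by blast
    moreover have "y = y [^]\<^bsub>PSL\<^esub> (1::nat)"
      using y by simp
    ultimately show ?thesis
      using y by blast
  next
    case False
    have "disc (dir B) \<noteq> 0"
    proof
      assume "disc (dir B) = 0"
      then show False
        using eq False by (simp add: A B component_label_semisimple component_label_unipotent)
    qed
    then have "line (dir A) = line (dir B)"
      using eq False by (simp add: A B component_label_semisimple)
    then obtain s where s: "dir B = scale s (dir A)"
      using self_in_line[of "dir B"] unfolding line_def by auto
    obtain g where g: "det g = 1" "\<And>C s. det C = 1 \<Longrightarrow> dir C = scale s (dir A) \<Longrightarrow>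
        \<exists>k::nat. C = g [^]\<^bsub>SL\<^esub> k"
      using SL2_cyclic[OF A(1) False] by blast
    obtain i :: nat where "A = g [^]\<^bsub>SL\<^esub> i"
      using g(2)[of A 1] A(1) by auto
    moreover obtain j :: nat where "B = g [^]\<^bsub>SL\<^esub> j"
      using g(2) B(1) s by blast
    ultimately have "x = proj g [^]\<^bsub>PSL\<^esub> i \<and> y = proj g [^]\<^bsub>PSL\<^esub> j"
      using A B pow_PSL[OF g(1)] by metis
    moreover have "proj g \<in> carrier PSL"
      unfolding carrier_PSL using g(1) by blast
    ultimately show ?thesis
      by blast
  qed
qed

section \<open>Counting\<close>

lemma four_eq_0_iff: "(4::'a::field) = 0 \<longleftrightarrow> (2::'a) = 0"
proof -
  have "(4::'a) = 2 * 2"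
    by simp
  then show ?thesis
    by (metis mult_eq_0_iff)
qed

lemma card_quadric:
  "card {(b, c, t). t\<^sup>2 + b * c = (0::'a::{field, finite})} = CARD('a)\<^sup>2"
proof -
  \<comment> \<open>For \<open>b \<noteq> 0\<close> the parameter \<open>s\<close> is
    \<open>t\<close> and determines \<open>c\<close>; for \<open>b = 0\<close> the equation forces
    \<open>t = 0\<close>, and \<open>s\<close> is the free entry \<open>c\<close>.\<close>
  define f :: "'a \<times> 'a \<Rightarrow> 'a \<times> 'a \<times> 'a"
    where "f = (\<lambda>(s, b). if b = 0 then (0, s, 0) else (b, - (s\<^sup>2 / b), s))"
  have "inj f"
    by (auto simp: inj_def f_def split: if_splits)
  moreover have "range f = {(b, c, t). t\<^sup>2 + b * c = 0}"
  proof safe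
    fix b c t :: 'a
    assume eq: "t\<^sup>2 + b * c = 0"
    show "(b, c, t) \<in> range f"
    proof (cases "b = 0")
      case True
      then show ?thesis
        using eq by (auto simp: f_def intro!: image_eqI[of _ _ "(c, 0)"])
    next
      case False
      then have "c = - (t\<^sup>2 / b)"
        using eq by (simp add: field_simps eq_neg_iff_add_eq_0 add.commute)
      then show ?thesis
        using False by (auto simp: f_def intro!: image_eqI[of _ _ "(t, b)"])
    qed
  qed (auto simp: f_def split: if_splits)
  ultimately show ?thesis
    using card_image[of f UNIV] by (simp add: power2_eq_square)
qed

text \<open>In characteristic 2 the discriminant is the square of \<open>e\<close>, leaving
  \<open>b\<close> and \<open>c\<close> free. Otherwise \<open>e = 2 * t\<close> reduces to the
  quadric.\<close>

lemma card_disc_eq_0: "card {v :: 'a::{field, finite} \<times> 'a \<times> 'a. disc v = 0} = CARD('a)\<^sup>2"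
proof (cases "(2::'a) = 0")
  case True
  then have "(4::'a) = 0"
    by (simp add: four_eq_0_iff)
  then have "{v :: 'a \<times> 'a \<times> 'a. disc v = 0} = UNIV \<times> UNIV \<times> {0}"
    by auto
  then show ?thesis
    by (simp add: card_cartesian_product power2_eq_square)
next
  case False
  let ?f = "\<lambda>(b, c, t). (b, c, 2 * t) :: 'a \<times> 'a \<times> 'a"
  have disc: "disc (?f (b, c, t)) = 4 * (t\<^sup>2 + b * c)" for b c t :: 'a
    by (simp add: algebra_simps power2_eq_square)
  have nz: "(4::'a) \<noteq> 0"
    using False by (simp add: four_eq_0_iff)
  have "{v :: 'a \<times> 'a \<times> 'a. disc v = 0} = ?f ` {(b, c, t). t\<^sup>2 + b * c = 0}"
  proof safe
    fix b c e :: 'a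
    assume "disc (b, c, e) = 0"
    then have "disc (?f (b, c, e / 2)) = 0"
      using False by simp
    then have "(e / 2)\<^sup>2 + b * c = 0"
      unfolding disc using nz by (metis mult_eq_0_iff)
    then show "(b, c, e) \<in> ?f ` {(b, c, t). t\<^sup>2 + b * c = 0}"
      using False by (intro image_eqI[of _ _ "(b, c, e / 2)"]) simp_all
  next
    fix b c t :: 'a
    assume "t\<^sup>2 + b * c = 0"
    then show "disc (b, c, 2 * t) = 0"
      using disc[of b c t] by simp
  qed
  moreover have "inj ?f"
    using False by (auto simp: inj_def)
  then have "inj_on ?f A" for A
    by (rule inj_on_subset) simp
  ultimately show ?thesis
    by (simp only: card_image card_quadric)
qed

text \<open>Trace 2 means a diagonal \<open>1 - t\<close>, \<open>1 + t\<close>; then the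
  determinant is 1 exactly on the quadric. This parametrisation works in every
  characteristic.\<close>

lemma card_unipotent:
  "card {A :: 'a::{field, finite} ^ 2 ^ 2. det A = 1 \<and> tr2 A = 2} = CARD('a)\<^sup>2"
proof -
  let ?f = "\<lambda>(b, c, t). mat2 (1 - t) b c (1 + t) :: 'a ^ 2 ^ 2"
  have "{A :: 'a ^ 2 ^ 2. det A = 1 \<and> tr2 A = 2} = ?f ` {(b, c, t). t\<^sup>2 + b * c = 0}"
  proof safe
    fix A :: "'a ^ 2 ^ 2"
    assume "det A = 1" "tr2 A = 2"
    then show "A \<in> ?f ` {(b, c, t). t\<^sup>2 + b * c = 0}"
    proof (cases A)
      fix a b c d
      assume A: "A = mat2 a b c d"
      then have a: "a = 1 - (d - 1)"
        using \<open>tr2 A = 2\<close> by (simp add: algebra_simps)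
      have eq: "(d - 1)\<^sup>2 + b * c = 1 - det A"
        unfolding A a by (simp add: power2_eq_square algebra_simps)
      show ?thesis
      proof (rule image_eqI)
        show "A = ?f (b, c, d - 1)"
          using A a by simp
        show "(b, c, d - 1) \<in> {(b, c, t). t\<^sup>2 + b * c = 0}"
          using eq \<open>det A = 1\<close> by simp
      qed
    qed
  next
    fix b c t :: 'a
    assume "t\<^sup>2 + b * c = 0"
    then show "det (mat2 (1 - t) b c (1 + t)) = 1"
      by (simp add: power2_eq_square algebra_simps)
  qed (simp add: algebra_simps)
  moreover have "inj ?f"
    by (auto simp: inj_def)
  then have "inj_on ?f A" for A
    by (rule inj_on_subset) simp
  ultimately show ?thesis
    by (simp only: card_image card_quadric)
qed

section \<open>Points of the projective plane with nonzero discriminant\<close>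

lemma card_line:
  assumes "v \<noteq> (0, 0, 0)"
  shows "card (line (v :: 'a::{field, finite} \<times> 'a \<times> 'a)) = CARD('a) - 1"
proof -
  have "line v = (\<lambda>s. scale s v) ` (UNIV - {0})"
    unfolding line_def by auto
  moreover have "inj_on (\<lambda>s. scale s v) (UNIV - {0})"
    using scale_eq_iff[OF assms] by (simp add: inj_on_def)
  ultimately show ?thesis
    by (simp add: card_image)
qed

text \<open>Scaling preserves nonvanishing of the discriminant, so the \<open>q^3 - q^2\<close> such
  vectors split into lines of \<open>q - 1\<close> vectors each.\<close>

lemma card_semisimple_lines:
  "card (line ` {v :: 'a::{field, finite} \<times> 'a \<times> 'a. disc v \<noteq> 0}) = CARD('a)\<^sup>2"
proof -
  let ?S = "{v :: 'a \<times> 'a \<times> 'a. disc v \<noteq> 0}" and ?q = "CARD('a)"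
  have q: "?q > 1"
    using card_mono[of UNIV "{0, 1 :: 'a}"] by simp
  have eq: "line w = line v" if w: "w \<in> line v" for v w :: "'a \<times> 'a \<times> 'a"
  proof -
    obtain s where "w = scale s v" "s \<noteq> 0"
      using w unfolding line_def by blast
    then show ?thesis
      by (simp add: line_scale)
  qed
  have "(?q - 1) * card (line ` ?S) = card (\<Union> (line ` ?S))"
  proof (rule card_partition)
    show "card c = ?q - 1" if "c \<in> line ` ?S" for c
    proof -
      obtain v where v: "disc v \<noteq> 0" "c = line v"
        using \<open>c \<in> line ` ?S\<close> by blast
      then have "v \<noteq> (0, 0, 0)"
        by auto
      then show ?thesis
        unfolding v(2) by (rule card_line)
    qed
    show "c1 \<inter> c2 = {}" if "c1 \<in> line ` ?S" "c2 \<in> line ` ?S" "c1 \<noteq> c2" for c1 c2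
      using that eq by blast
  qed simp_all
  also have "\<Union> (line ` ?S) = ?S"
  proof
    show "?S \<subseteq> \<Union> (line ` ?S)"
      using self_in_line by blast
    show "\<Union> (line ` ?S) \<subseteq> ?S"
    proof
      fix w
      assume "w \<in> \<Union> (line ` ?S)"
      then obtain v s where "disc v \<noteq> 0" "s \<noteq> 0" "w = scale s v"
        unfolding line_def by blast
      then show "w \<in> ?S"
        by simp
    qed
  qed
  also have "card ?S = card (UNIV :: ('a \<times> 'a \<times> 'a) set) - card {v :: 'a \<times> 'a \<times> 'a. disc v = 0}"
    by (subst card_Diff_subset[symmetric]) (auto intro: arg_cong[where f = card])
  also have "\<dots> = (?q - 1) * ?q\<^sup>2"
    by (simp add: card_disc_eq_0 power2_eq_square algebra_simps)
  finally show ?thesis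
    using q by simp
qed

text \<open>If \<open>w\<close> is a non-scalar element of the algebra then \<open>w\<close> divided by its conjugate, that is,
  \<open>w\<^sup>2 / det w\<close>, has determinant \<open>1\<close>; it is non-scalar unless the trace of \<open>w\<close> vanishes. At most
  three translates of \<open>w\<close> by scalars have vanishing trace or determinant.\<close>

lemma semisimple_line_meets_SL2:
  fixes v :: "'a::{field, finite} \<times> 'a \<times> 'a"
  assumes q: "CARD('a) > 3" and v: "disc v \<noteq> 0"
  obtains A s where "det A = 1" "dir A = scale s v" "s \<noteq> 0"
proof -
  obtain b c e where v_eq: "v = (b, c, e)"
    by (cases v) auto
  \<comment> \<open>The factors are the trace and the determinant of the translate
    \<open>mat2 x b c (x + e)\<close>, as polynomials in \<open>x\<close>.\<close>
  define P where "P = [:e, 2:] * [:- (b * c), e, 1:]"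
  have "(2::'a) \<noteq> 0 \<or> e \<noteq> 0"
  proof (rule ccontr)
    assume *: "\<not> ?thesis"
    then have "(4::'a) = 0"
      by (simp add: four_eq_0_iff)
    with * show False
      using v by (simp add: v_eq)
  qed
  then have "P \<noteq> 0"
    unfolding P_def by auto
  have "degree P \<le> degree [:e, 2:] + degree [:- (b * c), e, 1:]"
    unfolding P_def by (rule degree_mult_le)
  also have "\<dots> \<le> 3"
    by simp
  finally have "card {x. poly P x = 0} < CARD('a)"
    using card_poly_roots_bound[OF \<open>P \<noteq> 0\<close>] q by linarith
  then obtain x where x: "poly P x \<noteq> 0"
    by (metis (mono_tags) less_irrefl mem_Collect_eq UNIV_eq_I)
  define W where "W = mat2 x b c (x + e)"
  have "poly P x = tr2 W * det W"
    by (simp add: P_def W_def algebra_simps)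
  with x have nz: "tr2 W \<noteq> 0" "det W \<noteq> 0"
    by auto
  show thesis
  proof
    \<comment> \<open>By Cayley-Hamilton this matrix is the square of \<open>W\<close> divided by
      \<open>det W\<close>.\<close>
    show "det (lincomb W (-1) (tr2 W / det W)) = 1"
      using nz(2) by (simp add: det_lincomb power2_eq_square field_simps)
    show "dir (lincomb W (-1) (tr2 W / det W)) = scale (tr2 W / det W) v"
      by (simp add: W_def v_eq)
    show "tr2 W / det W \<noteq> 0"
      using nz by simp
  qed
qed

text \<open>Each of these classes has exactly one representative of trace 2: if both
  \<open>A\<close> and \<open>- A\<close> have it, the characteristic is 2 and they coincide. The
  identity is then removed from the count.\<close>

lemma card_unipotent_PSL2:
  "card {proj A | A :: 'a::{field, finite} ^ 2 ^ 2. det A = 1 \<and> dir A \<noteq> (0, 0, 0) \<and> disc (dir A) = 0}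
    = CARD('a)\<^sup>2 - 1"
proof -
  let ?T = "{A :: 'a ^ 2 ^ 2. det A = 1 \<and> tr2 A = 2}"
  have unique: "A = B" if "A \<in> ?T" "B \<in> ?T" "proj A = proj B" for A B
  proof (rule ccontr)
    assume "A \<noteq> B"
    then have "A = - B"
      using that proj_eq_iff by blast
    then have "(2::'a) = - 2"
      using that tr2_uminus[of B] by simp
    then have "(2::'a) = 0"
      by (simp add: eq_neg_iff_add_eq_0 four_eq_0_iff)
    then have "- x = x" for x :: 'a
      by (metis add_eq_0_iff mult_2 mult_zero_left)
    then show False
      using \<open>A = - B\<close> \<open>A \<noteq> B\<close> by (simp add: vec_eq_iff)
  qed
  have id: "mat 1 \<in> ?T"
    by (simp add: mat_1_eq_mat2)
  have "{proj A | A :: 'a ^ 2 ^ 2. det A = 1 \<and> dir A \<noteq> (0, 0, 0) \<and> disc (dir A) = 0} =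
      proj ` (?T - {mat 1})"
  proof (intro Set.set_eqI iffI)
    fix Y
    assume "Y \<in> {proj A | A :: 'a ^ 2 ^ 2. det A = 1 \<and> dir A \<noteq> (0, 0, 0) \<and> disc (dir A) = 0}"
    then obtain A where A: "Y = proj A" "det A = 1" "dir A \<noteq> (0, 0, 0)" "disc (dir A) = 0"
      by blast
    obtain B where B: "det B = 1" "tr2 B = 2" "proj B = proj A"
      using disc_eq_0_trace[OF A(2,4)] .
    have "B \<noteq> mat 1"
      using A(2,3) B(3) proj_eq_one_iff one_PSL by metis
    then show "Y \<in> proj ` (?T - {mat 1})"
      using A(1) B by auto
  next
    fix Y
    assume "Y \<in> proj ` (?T - {mat 1})"
    then obtain A where A: "A \<in> ?T" "A \<noteq> mat 1" "Y = proj A"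
      by blast
    then have "proj A \<noteq> \<one>\<^bsub>PSL\<^esub>"
      unfolding one_PSL using unique id by blast
    then have "dir A \<noteq> (0, 0, 0)"
      using A proj_eq_one_iff by blast
    moreover have "disc (dir A) = 0"
      using A by (simp add: disc_dir power2_eq_square)
    ultimately show "Y \<in> {proj A | A. det A = 1 \<and> dir A \<noteq> (0, 0, 0) \<and> disc (dir A) = 0}"
      using A by blast
  qed
  moreover have "inj_on proj (?T - {mat 1})"
    using unique by (auto intro: inj_onI)
  ultimately show ?thesis
    using id by (simp add: card_image card_unipotent)
qed

text \<open>Subgroups of order \<open>p\<close> meet trivially, so without the identity they
  partition these classes into blocks of size \<open>p - 1\<close>.\<close>

lemma card_unipotent_subgroups_PSL2:
  assumes p: "prime p" "of_nat p = (0::'a::{field, finite})"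
  shows "(p - 1) * card (nontrivial_powers PSL `
    {proj A | A :: 'a ^ 2 ^ 2. det A = 1 \<and> dir A \<noteq> (0, 0, 0) \<and> disc (dir A) = 0}) = CARD('a)\<^sup>2 - 1"
    (is "_ * card (_ ` ?U) = _")
proof -
  define W where "W = ?U"
  have U: "Y \<in> carrier PSL" "Y \<noteq> \<one>\<^bsub>PSL\<^esub>" "Y [^]\<^bsub>PSL\<^esub> p = \<one>\<^bsub>PSL\<^esub>" if "Y \<in> W" for Y
    using that proj_eq_one_iff unipotent_pow_eq_one[OF _ _ p(2)] by (auto simp: W_def carrier_PSL)
  have eq: "nontrivial_powers PSL Z = nontrivial_powers PSL Y"
    if "Y \<in> W" "Z \<in> nontrivial_powers PSL Y" for Y Z
    using that U[OF that(1)] p(1) by (intro PSL.nontrivial_powers_eq[of _ p]) auto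
  have "(p - 1) * card (nontrivial_powers PSL ` W) = card (\<Union> (nontrivial_powers PSL ` W))"
  proof (rule card_partition)
    show "card c = p - 1" if "c \<in> nontrivial_powers PSL ` W" for c
    proof -
      obtain Y where Y: "Y \<in> W" and c: "c = nontrivial_powers PSL Y"
        using \<open>c \<in> nontrivial_powers PSL ` W\<close> by blast
      show ?thesis
        unfolding c by (rule PSL.card_nontrivial_powers[OF _ U(1,2)[OF Y] p(1) U(3)[OF Y]]) simp
    qed
    show "c1 \<inter> c2 = {}"
      if "c1 \<in> nontrivial_powers PSL ` W" "c2 \<in> nontrivial_powers PSL ` W" "c1 \<noteq> c2" for c1 c2
      using that eq by blast
  qed simp_all
  also have "\<Union> (nontrivial_powers PSL ` W) = W"
  proof
    show "W \<subseteq> \<Union> (nontrivial_powers PSL ` W)"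
      using U PSL.self_in_nontrivial_powers by blast
    show "\<Union> (nontrivial_powers PSL ` W) \<subseteq> W"
    proof
      fix Y
      assume "Y \<in> \<Union> (nontrivial_powers PSL ` W)"
      then obtain A and k :: nat where A: "det A = 1" "disc (dir A) = 0"
        and Y: "Y = proj A [^]\<^bsub>PSL\<^esub> k" "Y \<noteq> \<one>\<^bsub>PSL\<^esub>"
        unfolding nontrivial_powers_def W_def by blast
      obtain s where s: "dir (A [^]\<^bsub>SL\<^esub> k) = scale s (dir A)"
        using dir_pow_SL[OF A(1)] .
      \<comment> \<open>The discriminant of a power is a multiple of the original one, so vanishing
        persists.\<close>
      have "Y = proj (A [^]\<^bsub>SL\<^esub> k)" "det (A [^]\<^bsub>SL\<^esub> k) = 1" "disc (dir (A [^]\<^bsub>SL\<^esub> k)) = 0"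
        using A Y(1) by (simp_all add: pow_PSL det_pow_SL s)
      moreover from this have "dir (A [^]\<^bsub>SL\<^esub> k) \<noteq> (0, 0, 0)"
        using Y(2) proj_eq_one_iff by blast
      ultimately show "Y \<in> W"
        unfolding W_def by blast
    qed
  qed
  finally show ?thesis
    unfolding W_def by (simp only: card_unipotent_PSL2)
qed

text \<open>The bound on the field size ensures that every line of nonzero discriminant is attained
  by a matrix of determinant 1.\<close>

lemma image_component_label:
  assumes q: "CARD('a::{field, finite}) > 3"
  shows "component_label ` (carrier PSL - {\<one>\<^bsub>PSL\<^esub>}) =
    line ` {v :: 'a \<times> 'a \<times> 'a. disc v \<noteq> 0} <+> nontrivial_powers PSL `
      {proj A | A. det A = 1 \<and> dir A \<noteq> (0, 0, 0) \<and> disc (dir A) = 0}"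
    (is "_ = ?L <+> _ ` ?U")
proof (intro Set.set_eqI iffI)
  fix c
  assume "c \<in> component_label ` (carrier PSL - {\<one>\<^bsub>PSL :: ('a ^ 2 ^ 2) set monoid\<^esub>})"
  then obtain A :: "'a ^ 2 ^ 2" where A: "det A = 1" "proj A \<noteq> \<one>\<^bsub>PSL\<^esub>" "c = component_label (proj A)"
    unfolding carrier_PSL by blast
  then have "dir A \<noteq> (0, 0, 0)"
    using proj_eq_one_iff by blast
  then show "c \<in> ?L <+> nontrivial_powers PSL ` ?U"
    using A(1,3) component_label_semisimple[of A] component_label_unipotent[of A]
    by (cases "disc (dir A) = 0") auto
next
  fix c
  assume "c \<in> ?L <+> nontrivial_powers PSL ` ?U"
  then show "c \<in> component_label ` (carrier PSL - {\<one>\<^bsub>PSL\<^esub>})"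
  proof (rule PlusE)
    fix l
    assume "l \<in> ?L" and c: "c = Inl l"
    then obtain v :: "'a \<times> 'a \<times> 'a" where v: "disc v \<noteq> 0" "l = line v"
      by blast
    obtain A s where A: "det A = 1" "dir A = scale s v" "s \<noteq> 0"
      using semisimple_line_meets_SL2[OF q v(1)] .
    have disc: "disc (dir A) \<noteq> 0"
      using A v by simp
    then have "proj A \<noteq> \<one>\<^bsub>PSL\<^esub>"
      using proj_eq_one_iff[OF A(1)] by auto
    moreover have "c = component_label (proj A)"
      unfolding c component_label_semisimple[OF disc] A(2) v(2) line_scale[OF A(3)] ..
    ultimately show ?thesis
      using A(1) unfolding carrier_PSL by blast
  next
    fix S
    assume "S \<in> nontrivial_powers PSL ` ?U" and c: "c = Inr S"
    then obtain A where A: "det A = 1" "dir A \<noteq> (0, 0, 0)" "disc (dir A) = 0"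
      "S = nontrivial_powers PSL (proj A)"
      by blast
    then have "c = component_label (proj A)" "proj A \<noteq> \<one>\<^bsub>PSL\<^esub>"
      using c component_label_unipotent proj_eq_one_iff by metis+
    then show ?thesis
      using A(1) unfolding carrier_PSL by blast
  qed
qed

theorem theorem3p6:
  fixes p n :: nat
  assumes "prime p" and "n > 0"
    and "CARD('a::{field, finite}) = p ^ n"
    and "p ^ n > 3"
  shows "real (card (connected_components (proper_power_graph (PSL :: ('a ^ 2 ^ 2) set monoid)))) =
    (real p ^ (2 * n + 1) - 1) / (real p - 1)"
proof -
  let ?U = "{proj A | A :: 'a ^ 2 ^ 2. det A = 1 \<and> dir A \<noteq> (0, 0, 0) \<and> disc (dir A) = 0}"
  \<comment> \<open>The characteristic divides the order of the field; as a field has no nilpotents,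
    \<open>p\<close> itself vanishes in it.\<close>
  have "of_nat (p ^ n) = (0::'a)"
    unfolding of_nat_eq_0_iff_char_dvd assms(3)[symmetric] by (rule CHAR_dvd_CARD)
  then have p: "of_nat p = (0::'a)"
    by simp
  have "card (connected_components (proper_power_graph (PSL :: ('a ^ 2 ^ 2) set monoid))) =
      card (component_label ` (carrier PSL - {\<one>\<^bsub>PSL :: ('a ^ 2 ^ 2) set monoid\<^esub>}))"
    by (rule PSL.card_components_proper_power_graph[OF finite component_label_pow[OF assms(1) p]
      component_label_eqD])
  also have "\<dots> = p ^ (2 * n) + card (nontrivial_powers PSL ` ?U)"
    unfolding image_component_label[OF assms(4)[folded assms(3)]]
    by (subst card_Plus) (simp_all add: card_semisimple_lines assms(3) power_even_eq)
  finally have count: "real (card (connected_components (proper_power_graph (PSL :: ('a ^ 2 ^ 2) set monoid)))) =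
      real p ^ (2 * n) + real (card (nontrivial_powers PSL ` ?U))"
    by simp
  have p1: "p > 1"
    using assms(1) by (rule prime_gt_1_nat)
  have "real (p - 1) * real (card (nontrivial_powers PSL ` ?U)) = real (p ^ (2 * n) - 1)"
    using card_unipotent_subgroups_PSL2[OF assms(1) p]
    unfolding assms(3) of_nat_mult[symmetric] by (simp add: power_even_eq)
  then have "(real p - 1) * real (card (nontrivial_powers PSL ` ?U)) = real p ^ (2 * n) - 1"
    using p1 by (simp add: of_nat_diff)
  \<comment> \<open>With \<open>q = p^n\<close>, the sum \<open>q^2 + (q^2 - 1) / (p - 1)\<close>
    equals \<open>(p * q^2 - 1) / (p - 1)\<close>.\<close>
  then show ?thesis
    unfolding count using p1 by (simp add: field_simps)
qed

end
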